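(* Let $d$ be even, let $c_1<\cdots<c_u$ be odd positive integers bounded by $d$, and let $H=H_d(c_1,\dots,c_u)=C_d(A(c_1,\dots,c_u,0,1))$. Let $P$ be the first summit and $Q$ the last summit of $H$. If $u=0$, then $H$ has exactly $d$ summits, $\operatorname{char}P=(0,1)$ and $\operatorname{char}Q=(d-1,0)$. If $u\ge1$, let $t=\tfrac12(d-c_u-1)$; then $t\ge0$, $H$ has exactly $(u+2)t+u$ summits, $\operatorname{char}P=(c_1,\dots,c_u,0,1)$ and $\operatorname{char}Q=(d-1,0,1+2t,c_1+2t+2,\dots,c_{u-1}+2t+2)$.
   Context: Conventions: $k$ a field; linear Nakayama algebras are basic $kQ/I$ with $Q$ a linearly oriented path; modules are finitely generated left modules, indecomposables uniserial; $|M|$ length, $\operatorname{pd}$ projective dimension, $\tau$ Auslander–Reiten translation. Simples $S_1,\dots,S_n$ with $\tau S_i=S_{i-1}$; $\omega_A=S_n$ the simple injective. Even/odd indecomposable: parity of projective dimension. For indecomposable $M$ with composition factors $F_1=\operatorname{soc}M,\dots,F_m=\operatorname{top}M$, $\operatorname{char}M=(z_1,\dots,z_m)$ with $z_i=\operatorname{pd}F_i$ if $F_i$ odd, $z_i=\operatorname{pd}M$ if $F_i$ even. Height = maximal length of indecomposables; summits = indecomposables of maximal length. Concave: Kupisch series weakly increases then weakly decreases. For concave $A$: first summit = summit $P$ with $\operatorname{rad}P$ projective; last summit = summit $Q$ with $Q/\operatorname{soc}Q$ injective. $A(\mathbf z)$ (ascent algebra): for a projective characteristic sequence $\mathbf z$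 (non-negative integers, exactly one even entry, equal to $0$), the unique ascending (weakly increasing Kupisch series) linear Nakayama algebra with $\operatorname{char}P(\omega_{A(\mathbf z)})=\mathbf z$. $C_d$ (partial $d$-closure): a simple $S$ is $d$-closed if torsionless or the socle of a module of projective dimension $\ge d$; the $d$-cliff module $Y_A=P(\omega_A)/U$ with $U$ the largest submodule of $P(\omega_A)$ with all composition factors $d$-closed; $E_d(A)$ is the one-point extension adding a simple $T=\tau^-\omega_A$ with $\operatorname{rad}P(T)\cong Y_A$ (or $A$ itself if $Y_A=0$); $C_d(A)=E_d^t(A)$ for $t$ with zero $d$-cliff module. *)

theory Defs
  imports Main
begin

text \<open>
A linear Nakayama algebra (up to isomorphism, over any field k) is encoded by its
Kupisch series, given as a list xs = [c_1, ..., c_n] with c_i the length of the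
indecomposable projective P_i = P(S_i).  Simples are S_1,...,S_n with
tau S_i = S_(i-1); S_1 is the simple projective and S_n = omega the simple injective.
The composition factors of P_i from top to socle are S_i, S_(i-1), ..., S_(i-c_i+1).
An indecomposable (uniserial) module is encoded by the pair (a,b): socle S_a,
top S_b, composition factors S_a,...,S_b from socle to top; it exists iff
1 <= a <= b <= n and b - a + 1 <= c_b.
\<close>

definition kc :: "nat list \<Rightarrow> nat \<Rightarrow> nat" where
  "kc xs i = xs ! (i - 1)"

definition is_LNakayama :: "nat list \<Rightarrow> bool" where
  "is_LNakayama xs \<longleftrightarrow> xs \<noteq> [] \<and> xs ! 0 = 1 \<and>
     (\<forall>i. 0 < i \<and> i < length xs \<longrightarrow> 2 \<le> xs ! i \<and> xs ! i \<le> xs ! (i - 1) + 1)"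

definition is_mod :: "nat list \<Rightarrow> nat \<Rightarrow> nat \<Rightarrow> bool" where
  "is_mod xs a b \<longleftrightarrow> 1 \<le> a \<and> a \<le> b \<and> b \<le> length xs \<and> b + 1 - a \<le> kc xs b"

definition is_proj :: "nat list \<Rightarrow> nat \<Rightarrow> nat \<Rightarrow> bool" where
  "is_proj xs a b \<longleftrightarrow> is_mod xs a b \<and> b + 1 - a = kc xs b"

definition is_inj :: "nat list \<Rightarrow> nat \<Rightarrow> nat \<Rightarrow> bool" where
  "is_inj xs a b \<longleftrightarrow> is_mod xs a b \<and> \<not> is_mod xs a (b + 1)"

text \<open>Projective dimension: the projective cover of (a,b) is P_b = (b+1-c_b, b),
the syzygy is (b+1-c_b, a-1).\<close>
function pdim :: "nat list \<Rightarrow> nat \<Rightarrow> nat \<Rightarrow> nat" where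
  "pdim xs a b = (if \<not> is_mod xs a b \<or> is_proj xs a b then 0
                   else Suc (pdim xs (b + 1 - kc xs b) (a - 1)))"
  by pat_completeness auto
termination
  by (relation "measure (\<lambda>(xs, a, b). b)") (auto simp: is_mod_def)

definition charseq :: "nat list \<Rightarrow> nat \<Rightarrow> nat \<Rightarrow> nat list" where
  "charseq xs a b = map (\<lambda>i. if odd (pdim xs i i) then pdim xs i i else pdim xs a b) [a..<b+1]"

definition char_proj_omega :: "nat list \<Rightarrow> nat list" where
  "char_proj_omega xs = charseq xs (length xs + 1 - kc xs (length xs)) (length xs)"

definition proj_char_seq :: "nat list \<Rightarrow> bool" where
  "proj_char_seq z \<longleftrightarrow> length (filter even z) = 1 \<and> (\<forall>x\<in>set z. even x \<longrightarrow> x = 0)"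

definition ascent :: "nat list \<Rightarrow> nat list" where
  "ascent z = (THE xs. is_LNakayama xs \<and> sorted xs \<and> char_proj_omega xs = z)"

definition d_closed :: "nat \<Rightarrow> nat list \<Rightarrow> nat \<Rightarrow> bool" where
  "d_closed d xs i \<longleftrightarrow> (\<exists>b. is_proj xs i b) \<or> (\<exists>b. is_mod xs i b \<and> d \<le> pdim xs i b)"

text \<open>U = (n+1-c_n, k) with k maximal such that all its composition factors are d-closed;
the d-cliff module Y = P(omega)/U = (k+1, n) has length n - k.\<close>
definition cliff_top_of_U :: "nat \<Rightarrow> nat list \<Rightarrow> nat" where
  "cliff_top_of_U d xs = (GREATEST k. k \<le> length xs \<and>
      (\<forall>j. length xs + 1 - kc xs (length xs) \<le> j \<and> j \<le> k \<longrightarrow> d_closed d xs j))"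

definition cliff_len :: "nat \<Rightarrow> nat list \<Rightarrow> nat" where
  "cliff_len d xs = length xs - cliff_top_of_U d xs"

text \<open>One-point extension: new simple T = S_(n+1) with rad P(T) = Y, so |P(T)| = |Y| + 1.\<close>
definition E_ext :: "nat \<Rightarrow> nat list \<Rightarrow> nat list" where
  "E_ext d xs = (if cliff_len d xs = 0 then xs else xs @ [cliff_len d xs + 1])"

definition C_closure :: "nat \<Rightarrow> nat list \<Rightarrow> nat list" where
  "C_closure d xs = (E_ext d ^^ (LEAST t. cliff_len d ((E_ext d ^^ t) xs) = 0)) xs"

definition height :: "nat list \<Rightarrow> nat" where
  "height xs = Max {b + 1 - a | a b. is_mod xs a b}"

definition summits :: "nat list \<Rightarrow> (nat \<times> nat) set" where
  "summits xs = {(a, b). is_mod xs a b \<and> b + 1 - a = height xs}"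

text \<open>First summit: summit P with rad P projective (rad P = (a, b-1), zero if a = b).\<close>
definition first_summit :: "nat list \<Rightarrow> nat \<Rightarrow> nat \<Rightarrow> bool" where
  "first_summit xs a b \<longleftrightarrow> (a, b) \<in> summits xs \<and> (a = b \<or> is_proj xs a (b - 1))"

text \<open>Last summit: summit Q with Q/soc Q injective (Q/soc Q = (a+1, b), zero if a = b).\<close>
definition last_summit :: "nat list \<Rightarrow> nat \<Rightarrow> nat \<Rightarrow> bool" where
  "last_summit xs a b \<longleftrightarrow> (a, b) \<in> summits xs \<and> (a = b \<or> is_inj xs (a + 1) b)"

end

theory Submission
  imports Defs
begin

text \<open>
Write \<open>F b = b - c_b\<close>, so that \<open>P_b = (F b + 1, b)\<close> and \<open>F\<close> is the parent map of a rooted tree on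
\<open>{0..n}\<close>, numbered level by level. The syzygy of \<open>(x+1, b)\<close> is \<open>(F b + 1, x)\<close>, so projective
dimensions are twice the distance to the lowest common ancestor, minus one if \<open>x\<close> and \<open>b\<close> lie on
the same level; \<open>S_b\<close> is odd iff \<open>b - 1\<close> and \<open>b\<close> share a level.

Put \<open>d = 2h\<close>, \<open>c_j = 2 m_j - 1\<close>, \<open>m_0 = 0\<close> and \<open>D = m_u\<close>. The tree of \<open>H\<close> is a spine
\<open>0, \<dots>, D + h + 1\<close> with, for each \<open>j\<close>, a path of \<open>h\<close> vertices attached to the spine at level
\<open>D - m_j\<close>: in the partial closure every vertex gets exactly one child until its branch has length
\<open>h\<close>, at which point it has become \<open>d\<close>-closed. The tree of the ascent algebra is the initial segment
ending with the second vertex of level \<open>D + 1\<close>. Conversely, iterating the parent map of any ascending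
algebra with the given characteristic sequence on the composition factors of \<open>P(\<omega>)\<close> recovers all
levels of that tree.
\<close>

section \<open>Kupisch series and parent maps\<close>

definition kupisch :: "(nat \<Rightarrow> nat) \<Rightarrow> nat \<Rightarrow> nat list" where
  "kupisch F n = map (\<lambda>i. i - F i) [1..<Suc n]"

lemma length_kupisch [simp]: "length (kupisch F n) = n"
  by (simp add: kupisch_def)

lemma nth_kupisch: "i < n \<Longrightarrow> kupisch F n ! i = Suc i - F (Suc i)"
  by (simp add: kupisch_def nth_append del: upt_Suc)

lemma kupisch_Suc: "kupisch F (Suc n) = kupisch F n @ [Suc n - F (Suc n)]"
  by (simp add: kupisch_def)

lemma kc_kupisch: "1 \<le> i \<Longrightarrow> i \<le> n \<Longrightarrow> kc (kupisch F n) i = i - F i"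
  by (simp add: kc_def nth_kupisch)

declare pdim.simps [simp del]

locale parent_map =
  fixes F :: "nat \<Rightarrow> nat" and n :: nat
  assumes parent_less: "0 < i \<Longrightarrow> i \<le> n \<Longrightarrow> F i < i"
begin

lemma is_mod_iff: "is_mod (kupisch F n) a b \<longleftrightarrow> 1 \<le> a \<and> a \<le> b \<and> b \<le> n \<and> F b < a"
  using parent_less[of b] by (auto simp: is_mod_def kc_kupisch)

lemma is_proj_iff: "is_proj (kupisch F n) a b \<longleftrightarrow> 1 \<le> b \<and> b \<le> n \<and> a = Suc (F b)"
  using parent_less[of b] by (auto simp: is_proj_def is_mod_iff kc_kupisch)

lemma pdim_step:
  assumes "F b \<le> x" "x < b" "b \<le> n"
  shows "pdim (kupisch F n) (Suc x) b =
    (if F b = x then 0 else Suc (pdim (kupisch F n) (Suc (F b)) x))"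
proof -
  have "Suc b - kc (kupisch F n) b = Suc (F b)"
    using assms by (simp add: kc_kupisch)
  then show ?thesis
    using assms by (subst pdim.simps) (auto simp: is_mod_iff is_proj_iff)
qed

end

text \<open>In terms of the Kupisch series, monotonicity of \<open>F\<close> is the condition
  c_(i+1) <= c_i + 1.\<close>

locale mono_parent_map = parent_map +
  assumes parent_mono: "i \<le> j \<Longrightarrow> j \<le> n \<Longrightarrow> F i \<le> F j"
begin

text \<open>The first syzygy of (x + 1, b) is (F b + 1, x), the second is (F x + 1, F b): two
  syzygies replace x and b by their parents.\<close>

lemma two_syzygies:
  assumes "F b \<le> x" "x < b" "b \<le> n" and "pdim (kupisch F n) (Suc x) b = Suc (Suc r)"
  shows "F b < x" "F x < F b" "F (F b) \<le> F x" "F b \<le> n"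
    "pdim (kupisch F n) (Suc (F x)) (F b) = r"
proof -
  show lt: "F b < x"
    using assms pdim_step[of b x] by (auto split: if_splits)
  then have 1: "pdim (kupisch F n) (Suc (F b)) x = Suc r"
    using assms pdim_step[of b x] by auto
  have le: "F x \<le> F b"
    using assms parent_mono by simp
  then have 2: "F x \<noteq> F b" "pdim (kupisch F n) (Suc (F x)) (F b) = r"
    using pdim_step[of x "F b"] lt assms 1 by (auto split: if_splits)
  then show "F x < F b" "pdim (kupisch F n) (Suc (F x)) (F b) = r"
    using le by auto
  show "F (F b) \<le> F x"
    using lt assms parent_mono by simp
  show "F b \<le> n"
    using lt assms by simp
qed

text \<open>The resolution stops at a projective first syzygy (F b + 1, x), that is, when F x = F b.
  So the paths of x and b to the root meet after equally many steps, and not earlier.\<close>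

lemma odd_pdim_funpow:
  assumes "F b \<le> x" "x < b" "b \<le> n" "pdim (kupisch F n) (Suc x) b = 2 * j + 1"
  shows "(\<forall>i\<le>j. (F ^^ i) x < (F ^^ i) b) \<and> (F ^^ Suc j) x = (F ^^ Suc j) b"
  using assms
proof (induction j arbitrary: x b)
  case 0
  then have 1: "F b < x" "pdim (kupisch F n) (Suc (F b)) x = 0"
    using pdim_step[of b x] by (auto split: if_splits)
  moreover have "F x \<le> F b"
    using 0 parent_mono by simp
  ultimately have "F x = F b"
    using pdim_step[of x "F b"] 0 by (auto split: if_splits)
  then show ?case
    using 0 by simp
next
  case (Suc j)
  note two = two_syzygies[OF Suc.prems(1-3), of "2 * j + 1"]
  have "(\<forall>i\<le>j. (F ^^ i) (F x) < (F ^^ i) (F b)) \<and> (F ^^ Suc j) (F x) = (F ^^ Suc j) (F b)"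
    using Suc.IH[of "F b" "F x"] two Suc.prems(4) by simp
  then have IH: "\<forall>i\<le>j. (F ^^ Suc i) x < (F ^^ Suc i) b"
      "(F ^^ Suc (Suc j)) x = (F ^^ Suc (Suc j)) b"
    by (simp_all add: funpow_swap1)
  have "(F ^^ i) x < (F ^^ i) b" if "i \<le> Suc j" for i
    using that IH(1) Suc.prems(2) by (cases i) auto
  then show ?case
    using IH(2) by blast
qed

text \<open>Here (x + 1, b) itself becomes projective, F b = x, so b needs one step more than x. The
  strict inequalities record that nothing coincides earlier.\<close>

lemma even_pdim_funpow:
  assumes "F b \<le> x" "x < b" "b \<le> n" "pdim (kupisch F n) (Suc x) b = 2 * j"
  shows "(\<forall>i\<le>j. (F ^^ i) x < (F ^^ i) b) \<and> (\<forall>i<j. (F ^^ Suc i) b < (F ^^ i) x)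
    \<and> (F ^^ Suc j) b = (F ^^ j) x"
  using assms
proof (induction j arbitrary: x b)
  case 0
  then show ?case
    using pdim_step[of b x] by (auto split: if_splits)
next
  case (Suc j)
  note two = two_syzygies[OF Suc.prems(1-3), of "2 * j"]
  have "(\<forall>i\<le>j. (F ^^ i) (F x) < (F ^^ i) (F b))
      \<and> (\<forall>i<j. (F ^^ Suc i) (F b) < (F ^^ i) (F x)) \<and> (F ^^ Suc j) (F b) = (F ^^ j) (F x)"
    using Suc.IH[of "F b" "F x"] two Suc.prems(4) by simp
  then have IH: "\<forall>i\<le>j. (F ^^ Suc i) x < (F ^^ Suc i) b"
      "\<forall>i<j. (F ^^ Suc (Suc i)) b < (F ^^ Suc i) x" "(F ^^ Suc (Suc j)) b = (F ^^ Suc j) x"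
    by (simp_all add: funpow_swap1)
  have "(F ^^ i) x < (F ^^ i) b" if "i \<le> Suc j" for i
    using that IH(1) Suc.prems(2) by (cases i) auto
  moreover have "(F ^^ Suc i) b < (F ^^ i) x" if "i < Suc j" for i
    using that IH(2) two(1) Suc.prems(4) by (cases i) auto
  ultimately show ?case
    using IH(3) by blast
qed

end

section \<open>Linear Nakayama algebras as monotone parent maps\<close>

lemma kc_le_index:
  assumes "is_LNakayama xs" "1 \<le> i" "i \<le> length xs"
  shows "kc xs i \<le> i"
  using assms(2,3)
proof (induction i rule: nat_induct_at_least)
  case base
  then show ?case
    using assms(1) by (simp add: is_LNakayama_def kc_def)
next
  case (Suc i)
  then have "xs ! i \<le> xs ! (i - 1) + 1"
    using assms(1) by (simp add: is_LNakayama_def)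
  then show ?case
    using Suc by (simp add: kc_def)
qed

lemma kupisch_of_parent:
  assumes "is_LNakayama xs"
  shows "kupisch (\<lambda>i. i - kc xs i) (length xs) = xs"
proof (rule nth_equalityI)
  fix i assume "i < length (kupisch (\<lambda>i. i - kc xs i) (length xs))"
  then show "kupisch (\<lambda>i. i - kc xs i) (length xs) ! i = xs ! i"
    using kc_le_index[OF assms, of "Suc i"] by (simp add: nth_kupisch) (simp add: kc_def)
qed simp

lemma kupisch_cong: "(\<And>i. 1 \<le> i \<Longrightarrow> i \<le> n \<Longrightarrow> F i = G i) \<Longrightarrow> kupisch F n = kupisch G n"
  by (auto simp: kupisch_def simp del: upt_Suc)

lemma kc_ge_2:
  assumes "is_LNakayama xs" "2 \<le> i" "i \<le> length xs"
  shows "2 \<le> kc xs i"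
proof -
  have "0 < i - 1 \<and> i - 1 < length xs"
    using assms by simp
  then show ?thesis
    using assms(1) unfolding is_LNakayama_def kc_def by blast
qed

lemma mono_parent_map_LNakayama:
  assumes "is_LNakayama xs"
  shows "mono_parent_map (\<lambda>i. i - kc xs i) (length xs)"
proof
  fix i assume i: "0 < i" "i \<le> length xs"
  have "kc xs i > 0"
  proof (cases "i = 1")
    case True
    then show ?thesis
      using assms by (simp add: is_LNakayama_def kc_def)
  next
    case False
    then show ?thesis
      using kc_ge_2[OF assms, of i] i by simp
  qed
  then show "i - kc xs i < i"
    using i by simp
next
  fix i j assume "i \<le> j" "j \<le> length xs"
  then show "i - kc xs i \<le> j - kc xs j"
  proof (induction j rule: dec_induct)
    case (step j)
    have "j - kc xs j \<le> Suc j - kc xs (Suc j)"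
    proof (cases "j = 0")
      case False
      then have "xs ! j \<le> xs ! (j - 1) + 1"
        using assms step by (simp add: is_LNakayama_def)
      then show ?thesis
        by (simp add: kc_def)
    qed simp
    then show ?case
      using step by simp
  qed simp
qed

text \<open>In an ascending algebra the parent map rises by at most one per step, and iterates
  inherit this.\<close>

lemma funpow_Suc_le:
  fixes G :: "nat \<Rightarrow> nat"
  assumes step: "\<And>i. i < n \<Longrightarrow> G i \<le> G (Suc i) \<and> G (Suc i) \<le> Suc (G i)"
    and le: "\<And>i. G i \<le> i" and "v < n"
  shows "(G ^^ k) v \<le> (G ^^ k) (Suc v) \<and> (G ^^ k) (Suc v) \<le> Suc ((G ^^ k) v)"
proof (induction k)
  case (Suc k)
  have "(G ^^ k) v \<le> v"
    by (induction k) (auto intro: le order_trans)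
  then have "(G ^^ k) v < n"
    using \<open>v < n\<close> by simp
  moreover have "(G ^^ k) (Suc v) = (G ^^ k) v \<or> (G ^^ k) (Suc v) = Suc ((G ^^ k) v)"
    using Suc by linarith
  ultimately show ?case
    using step[of "(G ^^ k) v"] by auto
qed simp

text \<open>The entries at most k form an initial segment, so counting them means comparing one
  entry with k. This turns the cardinalities \<open>W\<close> into bounds on a single m_j.\<close>

lemma Suc_le_card_le_iff:
  fixes xs :: "nat list"
  assumes "sorted_wrt (<) xs" "i < length xs"
  shows "Suc i \<le> card {x \<in> set xs. x \<le> k} \<longleftrightarrow> xs ! i \<le> k"
proof
  assume le: "xs ! i \<le> k"
  have "distinct xs"
    using assms(1) strict_sorted_iff by auto
  then have "Suc i = card (set (take (Suc i) xs))"
    using assms(2) by (simp add: distinct_card)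
  also have "\<dots> \<le> card {x \<in> set xs. x \<le> k}"
  proof (rule card_mono)
    have "xs ! j \<le> k" if "j \<le> i" for j
      using sorted_wrt_nth_less[OF assms(1), of j i] that assms(2) le by (cases "j = i") auto
    then show "set (take (Suc i) xs) \<subseteq> {x \<in> set xs. x \<le> k}"
      using assms(2) by (auto simp: set_take_subset[THEN subsetD] in_set_conv_nth[of _ "take _ _"])
  qed simp
  finally show "Suc i \<le> card {x \<in> set xs. x \<le> k}" .
next
  assume card: "Suc i \<le> card {x \<in> set xs. x \<le> k}"
  show "xs ! i \<le> k"
  proof (rule ccontr)
    assume gt: "\<not> xs ! i \<le> k"
    have "x \<in> set (take i xs)" if x: "x \<in> set xs" "x \<le> k" for x
    proof -
      obtain j where j: "j < length xs" "x = xs ! j"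
        using x(1) by (auto simp: in_set_conv_nth)
      have "j < i"
        using sorted_wrt_nth_less[OF assms(1), of i j] gt x(2) j
        by (cases i j rule: linorder_cases) auto
      then show ?thesis
        using j assms(2) by (auto simp: in_set_conv_nth)
    qed
    then have "{x \<in> set xs. x \<le> k} \<subseteq> set (take i xs)"
      by blast
    then have "card {x \<in> set xs. x \<le> k} \<le> card (set (take i xs))"
      by (simp add: card_mono)
    also have "\<dots> \<le> i"
      using card_length[of "take i xs"] by simp
    finally show False
      using card by simp
  qed
qed

section \<open>The tree of the partial closure\<close>

text \<open>\<open>ms\<close> lists m_0 = 0, m_1, ..., m_u. The bound on \<open>last ms\<close> says
  c_u <= d - 1; the branch m_0 = 0 produces the final entry 1 of the characteristic
  sequence.\<close>

locale branched_spine =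
  fixes ms :: "nat list" and h :: nat
  assumes sorted_ms: "sorted_wrt (<) ms" and ms_ne: "ms \<noteq> []" and hd_ms: "ms ! 0 = 0"
    and last_le: "last ms \<le> h" and h_pos: "0 < h"
begin

text \<open>
Branch \<open>m\<close> meets level \<open>l\<close> iff \<open>1 \<le> l + m - D \<le> h\<close>, and \<open>W l k\<close> counts the branches met that
started less than \<open>k\<close> levels before \<open>l\<close>. On each level the spine vertex comes first and younger
branches precede older ones, so \<open>S l + p\<close> with \<open>p \<le> N l\<close> is the \<open>p\<close>-th vertex of level \<open>l\<close>, and
two vertices \<open>S l + p\<close>, \<open>S l + q\<close> with \<open>p < q\<close> have a common ancestor \<open>k\<close> levels up iff
\<open>q \<le> W l k\<close>. The term \<open>new l\<close> is 1 if a branch starts on level \<open>l\<close>; its first vertex is then the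
second child of the spine vertex below it.
\<close>

definition D :: nat where "D = last ms"
definition u :: nat where "u = length ms - 1"
definition W :: "nat \<Rightarrow> nat \<Rightarrow> nat" where
  "W l k = card {m \<in> set ms. D < l + m \<and> l + m \<le> D + k}"
definition new :: "nat \<Rightarrow> nat" where
  "new l = (if \<exists>m\<in>set ms. l + m = Suc D then 1 else 0)"
abbreviation N :: "nat \<Rightarrow> nat" where "N l \<equiv> W l h"
definition S :: "nat \<Rightarrow> nat" where "S l = (\<Sum>i<l. Suc (N i))"
definition lev :: "nat \<Rightarrow> nat" where "lev i = (LEAST l. i < S (Suc l))"
definition F :: "nat \<Rightarrow> nat" where
  "F i = S (lev i - 1) + (i - S (lev i) - new (lev i))"

section \<open>Counting the branches that meet a level\<close>

lemma length_ms: "length ms = Suc u"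
  using ms_ne by (simp add: u_def)

lemma card_ms: "card (set ms) = Suc u"
  using sorted_ms by (simp add: distinct_card strict_sorted_iff length_ms)

lemma zero_in: "0 \<in> set ms"
  using ms_ne hd_ms nth_mem[of 0 ms] by simp

lemma D_in: "D \<in> set ms"
  using ms_ne by (simp add: D_def)

lemma nth_u: "ms ! u = D"
  using ms_ne by (simp add: D_def u_def last_conv_nth)

lemma le_D: assumes "m \<in> set ms" shows "m \<le> D"
proof -
  obtain i where "i < length ms" "m = ms ! i"
    using assms by (auto simp: in_set_conv_nth)
  then show ?thesis
    using sorted_wrt_nth_less[OF sorted_ms, of i u] length_ms nth_u by (cases "i = u") auto
qed

lemma D_le_h: "D \<le> h"
  using last_le by (simp add: D_def)

lemma card_eq_new: "card {m \<in> set ms. l + m = Suc D} = new l"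
proof (cases "\<exists>m\<in>set ms. l + m = Suc D")
  case True
  then obtain m where "m \<in> set ms" "l + m = Suc D"
    by blast
  then have "{m \<in> set ms. l + m = Suc D} = {m}"
    by auto
  then show ?thesis
    using True by (simp add: new_def)
next
  case False
  then have "{m \<in> set ms. l + m = Suc D} = {}"
    by auto
  then show ?thesis
    using False by (simp add: new_def)
qed

lemma new_le: "new l \<le> 1"
  by (simp add: new_def)

lemma W_0_right [simp]: "W l 0 = 0"
  by (simp add: W_def)

lemma W_0_left [simp]: "W 0 k = 0"
proof -
  have "{m \<in> set ms. D < 0 + m \<and> 0 + m \<le> D + k} = {}"
    using le_D by fastforce
  then show ?thesis
    by (simp only: W_def card.empty)
qed

text \<open>From one level to the next every branch ages by one, and a starting branch has age
  one.\<close>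

lemma W_Suc_Suc: "W (Suc l) (Suc k) = W l k + new (Suc l)"
proof -
  have "{m \<in> set ms. D < Suc l + m \<and> Suc l + m \<le> D + Suc k} =
      {m \<in> set ms. D < l + m \<and> l + m \<le> D + k} \<union> {m \<in> set ms. Suc l + m = Suc D}"
    by auto
  then show ?thesis
    unfolding W_def card_eq_new[symmetric] by (simp only:) (rule card_Un_disjoint; auto)
qed

lemma W_mono: "k \<le> k' \<Longrightarrow> W l k \<le> W l k'"
  unfolding W_def by (rule card_mono) auto

lemma W_le: "W l k \<le> Suc u"
  unfolding W_def card_ms[symmetric] by (rule card_mono) auto

lemma W_Suc_right: "W l (Suc k) = W l k + (if \<exists>m\<in>set ms. l + m = Suc (D + k) then 1 else 0)"
proof -
  have "{m \<in> set ms. D < l + m \<and> l + m \<le> D + Suc k} =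
      {m \<in> set ms. D < l + m \<and> l + m \<le> D + k} \<union> {m \<in> set ms. l + m = Suc (D + k)}"
    by auto
  then have "W l (Suc k) = W l k + card {m \<in> set ms. l + m = Suc (D + k)}"
    unfolding W_def by (simp only:) (rule card_Un_disjoint; auto)
  moreover have "{m \<in> set ms. l + m = Suc (D + k)} = {m}" if "m \<in> set ms" "l + m = Suc (D + k)" for m
    using that by auto
  ultimately show ?thesis
    by (cases "\<exists>m\<in>set ms. l + m = Suc (D + k)") auto
qed

lemma W_1_right: "W l 1 = new l"
  using W_Suc_right[of l 0] by (simp add: new_def)

lemma N_Suc: "N (Suc l) = W l (h - 1) + new (Suc l)"
  using W_Suc_Suc[of l "h - 1"] h_pos by simp

lemma N_cases: "N l = W l (h - 1) \<or> N l = Suc (W l (h - 1))"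
  using W_Suc_right[of l "h - 1"] h_pos by (auto split: if_splits)

lemma W_pred_le: "W l (h - 1) \<le> N l"
  by (simp add: W_mono)

lemma le_W_D_iff:
  assumes "0 < j" "j \<le> u"
  shows "j \<le> W D k \<longleftrightarrow> ms ! j \<le> k"
proof -
  have "{m \<in> set ms. m \<le> k} = insert 0 {m \<in> set ms. D < D + m \<and> D + m \<le> D + k}"
    using zero_in by auto
  then have "card {m \<in> set ms. m \<le> k} = Suc (W D k)"
    by (simp add: W_def)
  then show ?thesis
    using Suc_le_card_le_iff[OF sorted_ms, of j k] assms length_ms by simp
qed

lemma W_D_le: "W D k \<le> u"
proof -
  have "{m \<in> set ms. D < D + m \<and> D + m \<le> D + k} \<subseteq> set ms - {0}"
    by auto
  then have "W D k \<le> card (set ms - {0})"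
    unfolding W_def by (rule card_mono[rotated]) simp
  then show ?thesis
    using zero_in card_ms by simp
qed

text \<open>As D <= h, no branch is over before level D. So each of the u branches with m > 0 either
  meets level l or starts on one of the levels l + 1, ..., D; \<open>W D (D - l)\<close> counts the
  latter.\<close>

lemma N_low: assumes "l \<le> D" shows "N l + W D (D - l) = u"
proof -
  have "set ms - {0} = {m \<in> set ms. D < l + m \<and> l + m \<le> D + h}
      \<union> {m \<in> set ms. D < D + m \<and> D + m \<le> D + (D - l)}" (is "_ = ?A \<union> ?B")
    using assms le_D D_le_h by fastforce
  moreover have "card (?A \<union> ?B) = card ?A + card ?B"
    using assms by (intro card_Un_disjoint) auto
  moreover have "card (set ms - {0}) = u"
    using zero_in card_ms by simp
  ultimately show ?thesis
    by (simp add: W_def)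
qed

lemma N_D: "N D = u"
  using N_low[of D] by simp

lemma new_low: assumes "l < D" shows "W D (D - l) = W D (D - Suc l) + new (Suc l)"
proof -
  have "Suc (D - Suc l) = D - l"
    using assms by simp
  moreover have "D + m = Suc (D + (D - Suc l)) \<longleftrightarrow> Suc l + m = Suc D" for m
    using assms by linarith
  ultimately show ?thesis
    using W_Suc_right[of D "D - Suc l"] unfolding new_def by simp
qed

lemma new_Suc_D [simp]: "new (Suc D) = 1"
  using zero_in by (auto simp: new_def)

lemma new_high: "Suc D < l \<Longrightarrow> new l = 0"
  by (auto simp: new_def)

lemma N_pos: assumes "0 < l" "l \<le> D + h" shows "0 < N l"
proof -
  have "\<exists>m\<in>set ms. D < l + m \<and> l + m \<le> D + h"
  proof (cases "l \<le> h")
    case True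
    then show ?thesis
      using D_in assms by (intro bexI[of _ D]) auto
  next
    case False
    then show ?thesis
      using zero_in assms D_le_h by (intro bexI[of _ 0]) auto
  qed
  then show ?thesis
    unfolding W_def by (auto simp: card_gt_0_iff)
qed

text \<open>The youngest branch, m = 0, starts on level D + 1; the oldest, m = D, ends on level
  h.\<close>

lemma N_full_iff: "N l = Suc u \<longleftrightarrow> D < l \<and> l \<le> h"
proof
  assume "N l = Suc u"
  then have "{m \<in> set ms. D < l + m \<and> l + m \<le> D + h} = set ms"
    by (intro card_subset_eq) (auto simp: W_def card_ms)
  then have "D < l + 0 \<and> l + 0 \<le> D + h" "D < l + D \<and> l + D \<le> D + h"
    using zero_in D_in by blast+
  then show "D < l \<and> l \<le> h"
    by simp
next
  assume "D < l \<and> l \<le> h"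
  then have "{m \<in> set ms. D < l + m \<and> l + m \<le> D + h} = set ms"
    using le_D by fastforce
  then show "N l = Suc u"
    by (simp add: W_def card_ms)
qed

lemma N_Suc_h: "N (Suc h) = u"
proof -
  have "{m \<in> set ms. D < Suc h + m \<and> Suc h + m \<le> D + h} = set ms - {D}"
    using le_D D_le_h by fastforce
  then show ?thesis
    using D_in card_ms by (simp add: W_def)
qed

lemma N_end: "N (Suc (D + h)) = 0"
  by (auto simp: W_def)

section \<open>Levels and the parent map of the tree\<close>

lemma S_0 [simp]: "S 0 = 0"
  by (simp add: S_def)

lemma S_Suc: "S (Suc l) = Suc (S l + N l)"
  by (simp add: S_def)

lemma strict_mono_S: "strict_mono S"
  by (simp add: strict_mono_Suc_iff S_Suc)

lemma S_le_iff: "S l \<le> S l' \<longleftrightarrow> l \<le> l'"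
  by (rule strict_mono_less_eq[OF strict_mono_S])

lemma S_less_iff: "S l < S l' \<longleftrightarrow> l < l'"
  by (rule strict_mono_less[OF strict_mono_S])

lemma position: obtains l p where "i = S l + p" "p \<le> N l"
proof -
  have "\<exists>l p. i = S l + p \<and> p \<le> N l"
  proof (induction i)
    case 0
    have "0 = S 0 + 0 \<and> 0 \<le> N 0"
      by simp
    then show ?case
      by blast
  next
    case (Suc i)
    then obtain l p where lp: "i = S l + p" "p \<le> N l"
      by blast
    show ?case
    proof (cases "p < N l")
      case True
      then have "Suc i = S l + Suc p \<and> Suc p \<le> N l"
        using lp by simp
      then show ?thesis
        by blast
    next
      case False
      then have "Suc i = S (Suc l) + 0 \<and> 0 \<le> N (Suc l)"
        using lp by (simp add: S_Suc)
      then show ?thesis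
        by blast
    qed
  qed
  then show ?thesis
    using that by blast
qed

lemma position_Suc:
  assumes "0 < i" obtains l p where "i = S (Suc l) + p" "p \<le> N (Suc l)"
proof (rule position[of i])
  fix l p assume "i = S l + p" "p \<le> N l"
  with assms that show thesis
    by (cases l) auto
qed

lemma lev_position: assumes "p \<le> N l" shows "lev (S l + p) = l"
  unfolding lev_def
proof (rule Least_equality)
  show "S l + p < S (Suc l)"
    using assms by (simp add: S_Suc)
next
  fix l' assume "S l + p < S (Suc l')"
  then have "S l < S (Suc l')"
    by simp
  then show "l \<le> l'"
    by (simp add: S_less_iff)
qed

text \<open>A starting branch takes position 1 and shifts the older ones by one; truncated
  subtraction then sends positions 0 and 1 both to the spine vertex of the preceding level.\<close>

lemma F_position: "p \<le> N (Suc l) \<Longrightarrow> F (S (Suc l) + p) = S l + (p - new (Suc l))"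
  by (simp add: F_def lev_position)

lemma F_first: "F (S (Suc l)) = S l"
  using F_position[of 0 l] by simp

text \<open>\<open>W l (h - 1)\<close> is the position of the last vertex of level l that has a
  child; it differs from \<open>N l\<close> exactly when a branch ends on level l.\<close>

lemma F_last: "F (S (Suc l) + N (Suc l)) = S l + W l (h - 1)"
  by (simp add: F_position) (simp add: N_Suc)

lemma F_0 [simp]: "F 0 = 0"
  using lev_position[of 0 0] by (simp add: F_def)

lemma F_less: assumes "0 < i" shows "F i < i"
proof (rule position_Suc[OF assms])
  fix l p assume "i = S (Suc l) + p" "p \<le> N (Suc l)"
  then have "F i = S l + (p - new (Suc l))" "i = Suc (S l + N l + p)"
    by (simp_all add: F_position) (simp add: S_Suc)
  then show ?thesis
    by simp
qed

lemma F_Suc_cases: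
  assumes "0 < i"
  obtains (inner) l p where "i = S (Suc l) + p" "p < N (Suc l)" "F i = S l + (p - new (Suc l))"
      "F (Suc i) = S l + (Suc p - new (Suc l))"
  | (last) l where "i = S (Suc l) + N (Suc l)" "F i = S l + W l (h - 1)" "F (Suc i) = S (Suc l)"
proof (rule position_Suc[OF assms])
  fix l p assume lp: "i = S (Suc l) + p" "p \<le> N (Suc l)"
  show thesis
  proof (cases "p < N (Suc l)")
    case True
    then show ?thesis
      using inner[of l p] lp F_position[of p l] F_position[of "Suc p" l] by simp
  next
    case False
    then have "Suc i = S (Suc (Suc l))"
      using lp by (simp add: S_Suc)
    then show ?thesis
      using last[of l] False lp F_last[of l] F_first[of "Suc l"] by simp
  qed
qed

lemma F_1: "F (Suc 0) = 0"
  using F_less[of "Suc 0"] by simp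

lemma F_le_Suc: "F i \<le> F (Suc i)"
proof (cases "i = 0")
  case False
  then have "0 < i"
    by simp
  then show ?thesis
    by (cases rule: F_Suc_cases) (use W_pred_le in \<open>auto simp: S_Suc le_SucI\<close>)
qed simp

lemma F_mono: "i \<le> j \<Longrightarrow> F i \<le> F j"
  by (rule lift_Suc_mono_le[of F]) (rule F_le_Suc)

section \<open>Projective dimensions read off from the tree\<close>

lemma mono_parent_map_F: "mono_parent_map F n"
  by unfold_locales (simp_all add: F_less F_mono)

lemma is_mod_kupisch_F: "is_mod (kupisch F n) a b \<longleftrightarrow> 1 \<le> a \<and> a \<le> b \<and> b \<le> n \<and> F b < a"
  by (rule parent_map.is_mod_iff[OF mono_parent_map.axioms(1)[OF mono_parent_map_F]])

lemma is_proj_kupisch_F: "is_proj (kupisch F n) a b \<longleftrightarrow> 1 \<le> b \<and> b \<le> n \<and> a = Suc (F b)"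
  by (rule parent_map.is_proj_iff[OF mono_parent_map.axioms(1)[OF mono_parent_map_F]])

lemma pdim_step_F:
  assumes "F b \<le> x" "x < b" "b \<le> n"
  shows "pdim (kupisch F n) (Suc x) b =
    (if F b = x then 0 else Suc (pdim (kupisch F n) (Suc (F b)) x))"
  by (rule parent_map.pdim_step[OF mono_parent_map.axioms(1)[OF mono_parent_map_F] assms])

text \<open>The bounds on q say that the two vertices first share an ancestor k + 1 levels up. Two
  syzygies pass to their parents, where \<open>W_Suc_Suc\<close> gives the same bounds with k
  lowered by one.\<close>

lemma pdim_same_level:
  assumes "p < q" "q \<le> N l" "S l + q \<le> n" "W l k < q" "q \<le> W l (Suc k)"
  shows "pdim (kupisch F n) (Suc (S l + p)) (S l + q) = 2 * k + 1"
  using assms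
proof (induction k arbitrary: l p q)
  case 0
  then obtain l' where l: "l = Suc l'"
    by (cases l) auto
  \<comment> \<open>A common parent forces the spine vertex and the first vertex of a new
    branch.\<close>
  have new: "new (Suc l') = 1" "q = 1" "p = 0"
    using 0 new_le[of l] l by (auto simp: W_1_right[simplified])
  have F: "F (S l + q) = S l'" "F (S l + p) = S l'"
    using F_position[of q l'] F_first[of l'] new 0 l by simp_all
  show ?case
    using pdim_step_F[of "S l + q" "S l + p" n] pdim_step_F[of "S l" "S l'" n] F new 0 l
    by (simp add: S_Suc)
next
  case (Suc k)
  then obtain l' where l: "l = Suc l'"
    by (cases l) auto
  let ?e = "new l"
  have e: "?e < q" "q - ?e \<le> W l' (Suc k)" "W l' k < q - ?e"
    using Suc.prems W_Suc_Suc[of l' k] W_Suc_Suc[of l' "Suc k"] l by auto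
  then have pq: "p - ?e < q - ?e"
    using Suc.prems by auto
  have F: "F (S l + q) = S l' + (q - ?e)" "F (S l + p) = S l' + (p - ?e)"
    using Suc.prems l by (simp_all add: F_position)
  have N: "q - ?e \<le> N l'"
    using Suc.prems N_Suc[of l'] W_pred_le[of l'] l by simp
  have S: "S l = Suc (S l' + N l')"
    by (simp add: l S_Suc)
  have IH: "pdim (kupisch F n) (Suc (S l' + (p - ?e))) (S l' + (q - ?e)) = 2 * k + 1"
    using Suc.prems N S e pq by (intro Suc.IH) auto
  have "pdim (kupisch F n) (Suc (S l + p)) (S l + q)
      = Suc (pdim (kupisch F n) (Suc (S l' + (q - ?e))) (S l + p))"
    using pdim_step_F[of "S l + q" "S l + p" n] F S N Suc.prems by simp
  also have "pdim (kupisch F n) (Suc (S l' + (q - ?e))) (S l + p)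
      = Suc (pdim (kupisch F n) (Suc (S l' + (p - ?e))) (S l' + (q - ?e)))"
    using pdim_step_F[of "S l + p" "S l' + (q - ?e)" n] F S N pq Suc.prems by simp
  finally show ?case
    using IH by simp
qed

lemma W_jump:
  assumes "0 < q" "q \<le> W l k"
  obtains j where "j < k" "W l j < q" "q \<le> W l (Suc j)"
proof -
  define j where "j = (LEAST i. q \<le> W l (Suc i))"
  obtain k' where k: "k = Suc k'"
    using assms by (cases k) auto
  have 1: "q \<le> W l (Suc j)"
    unfolding j_def by (rule LeastI[of _ k']) (use assms k in simp)
  have "j \<le> k'"
    unfolding j_def by (rule Least_le) (use assms k in simp)
  moreover have "W l j < q"
  proof (cases j)
    case (Suc i)
    then have "i < j"
      by simp
    then show ?thesis
      unfolding j_def using not_less_Least Suc j_def not_le by metis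
  qed (use assms in simp)
  ultimately show ?thesis
    using that[of j] 1 k by simp
qed

text \<open>The syzygy lies within level l, between the parent of the top and position p, so
  \<open>pdim_same_level\<close> applies to it.\<close>

lemma pdim_next_level:
  assumes "q \<le> N (Suc l)" "q - new (Suc l) < p" "p \<le> N l" "S (Suc l) + q \<le> n"
    "W l k < p" "p \<le> W l (Suc k)"
  shows "pdim (kupisch F n) (Suc (S l + p)) (S (Suc l) + q) = 2 * k + 2"
proof -
  have F: "F (S (Suc l) + q) = S l + (q - new (Suc l))"
    using assms by (simp add: F_position)
  have "pdim (kupisch F n) (Suc (S l + (q - new (Suc l)))) (S l + p) = 2 * k + 1"
    using assms by (intro pdim_same_level) (simp_all add: S_Suc)
  then show ?thesis
    using pdim_step_F[of "S (Suc l) + q" "S l + p" n] F assms by (simp add: S_Suc)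
qed

lemma even_pdim_first:
  assumes "S (Suc l) \<le> n"
  shows "even (pdim (kupisch F n) (S (Suc l)) (S (Suc l)))"
proof (cases "N l = 0")
  case True
  then have "S (Suc l) = Suc (S l)"
    by (simp add: S_Suc)
  then show ?thesis
    using pdim_step_F[of "S (Suc l)" "S l" n] assms F_first[of l] by simp
next
  case False
  then obtain k where k: "W l k < N l" "N l \<le> W l (Suc k)"
    by (auto elim: W_jump[of "N l" l h])
  then have "pdim (kupisch F n) (Suc (S l + N l)) (S (Suc l) + 0) = 2 * k + 2"
    using assms False by (intro pdim_next_level) auto
  then show ?thesis
    by (simp add: S_Suc)
qed

lemma pdim_simple_D:
  assumes "0 < j" "j \<le> u" "S D + j \<le> n"
  shows "pdim (kupisch F n) (S D + j) (S D + j) = 2 * ms ! j - 1"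
proof -
  have "0 < ms ! j"
    using sorted_wrt_nth_less[OF sorted_ms, of 0 j] assms length_ms by simp
  then obtain k where k: "ms ! j = Suc k"
    using gr0_implies_Suc by blast
  have "pdim (kupisch F n) (Suc (S D + (j - 1))) (S D + j) = 2 * k + 1"
    using assms k le_W_D_iff[of j k] le_W_D_iff[of j "Suc k"]
    by (intro pdim_same_level) (auto simp: N_D not_le)
  then show ?thesis
    using assms k by simp
qed

text \<open>On level h + 1 only the oldest branch m_u = D is over. The branches m_0, ..., m_(u-1)
  occupy positions 1, ..., u, and m_i has age h + 1 - D + m_i.\<close>

lemma le_W_Suc_h_iff:
  assumes "i < u"
  shows "Suc i \<le> W (Suc h) k \<longleftrightarrow> Suc (h - D + ms ! i) \<le> k"
proof (cases "Suc (h - D) \<le> k")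
  case True
  then have "W (Suc h) k = card {m \<in> set ms. m \<le> k - Suc (h - D)}"
    unfolding W_def using D_le_h by (intro arg_cong[of _ _ card] Collect_cong) auto
  then show ?thesis
    using Suc_le_card_le_iff[OF sorted_ms, of i "k - Suc (h - D)"] True assms length_ms by auto
next
  case False
  then have "{m \<in> set ms. D < Suc h + m \<and> Suc h + m \<le> D + k} = {}"
    using D_le_h by auto
  then have "W (Suc h) k = 0"
    unfolding W_def by (simp only: card.empty)
  then show ?thesis
    using False by simp
qed

lemma pdim_simple_Suc_h:
  assumes "i < u" "S (Suc h) + Suc i \<le> n"
  shows "pdim (kupisch F n) (S (Suc h) + Suc i) (S (Suc h) + Suc i) = 2 * (h - D + ms ! i) + 1"
proof -
  have "pdim (kupisch F n) (Suc (S (Suc h) + i)) (S (Suc h) + Suc i) = 2 * (h - D + ms ! i) + 1"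
    using assms le_W_Suc_h_iff[of i "h - D + ms ! i"] le_W_Suc_h_iff[of i "Suc (h - D + ms ! i)"]
    by (intro pdim_same_level) (auto simp: N_Suc_h)
  then show ?thesis
    by simp
qed

section \<open>The last vertices of the ascent algebra and of its closure\<close>

definition n_asc :: nat where "n_asc = Suc (S (Suc D))"
text \<open>By \<open>N_end\<close> the spine vertex is alone on level D + h + 1, where all branches
  are over.\<close>

definition n_closure :: nat where "n_closure = S (Suc (D + h))"

lemma N_Suc_D_pos: "1 \<le> N (Suc D)"
  using N_pos[of "Suc D"] h_pos by simp

lemma F_n_asc: "F n_asc = S D" "F (S (Suc D)) = S D"
  using F_position[of 1 D] N_Suc_D_pos F_first by (simp_all add: n_asc_def)

lemma n_asc_eq: "n_asc = S D + Suc (Suc u)"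
  by (simp add: n_asc_def S_Suc N_D)

lemma n_asc_le: "n_asc \<le> n_closure"
proof -
  have "S (Suc (Suc D)) \<le> S (Suc (D + h))"
    using h_pos by (simp add: S_le_iff)
  then show ?thesis
    using N_Suc_D_pos by (simp add: n_asc_def n_closure_def S_Suc[of "Suc D"])
qed

text \<open>The factors are the u branch vertices of level D, the spine vertex of level D + 1, which
  is even and receives the entry 0, and the first vertex of branch 0. Arbitrary n serves both the
  ascent algebra and the first summit of the closure.\<close>

lemma charseq_first:
  assumes "n_asc \<le> n"
  shows "charseq (kupisch F n) (Suc (S D)) n_asc = map (\<lambda>m. 2 * m - 1) (tl ms) @ [0, 1]"
proof -
  let ?p = "pdim (kupisch F n)"
  let ?z = "\<lambda>i. if odd (?p i i) then ?p i i else ?p (Suc (S D)) n_asc"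
  have proj: "?p (Suc (S D)) n_asc = 0"
    using pdim_step_F[of n_asc "S D" n] assms F_n_asc n_asc_eq by simp
  have l1: "?z (S (Suc D)) = 0"
    using even_pdim_first[of D n] assms proj by (simp add: n_asc_def)
  have l2: "?p n_asc n_asc = 1"
    using pdim_same_level[of 0 1 "Suc D" n 0] N_Suc_D_pos assms
    by (simp add: n_asc_def W_1_right[simplified])
  have init: "map ?z [Suc (S D)..<Suc (S D) + u] = map (\<lambda>m. 2 * m - 1) (tl ms)"
  proof (rule nth_equalityI)
    fix i assume "i < length (map ?z [Suc (S D)..<Suc (S D) + u])"
    then have i: "i < u"
      by (simp only: length_map length_upt)
    then have "?p (S D + Suc i) (S D + Suc i) = 2 * ms ! Suc i - 1"
      using assms n_asc_eq by (intro pdim_simple_D) auto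
    moreover have "0 < ms ! Suc i"
      using sorted_wrt_nth_less[OF sorted_ms, of 0 "Suc i"] i length_ms by simp
    ultimately show "map ?z [Suc (S D)..<Suc (S D) + u] ! i = map (\<lambda>m. 2 * m - 1) (tl ms) ! i"
      using i length_ms by (simp add: nth_tl del: upt_Suc)
  qed (simp add: length_ms)
  have "[Suc (S D)..<n_asc + 1] = [Suc (S D)..<Suc (S D) + u] @ [S (Suc D), n_asc]"
    by (simp add: n_asc_def S_Suc N_D)
  then have "charseq (kupisch F n) (Suc (S D)) n_asc
      = map ?z [Suc (S D)..<Suc (S D) + u] @ [?z (S (Suc D)), ?z n_asc]"
    by (simp add: charseq_def)
  then show ?thesis
    using init l1 l2 by simp
qed

text \<open>After \<open>n_asc\<close> no branch starts, so no later vertex shares its parent with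
  its predecessor.\<close>

lemma F_strict: assumes "n_asc \<le> n" shows "F n < F (Suc n)"
proof -
  have "0 < n"
    using assms by (simp add: n_asc_def)
  then show ?thesis
  proof (cases rule: F_Suc_cases)
    case (inner l p)
    have "S (Suc D) < S (Suc (Suc l))"
      using inner assms by (simp add: n_asc_def S_Suc[of "Suc l"])
    then have "D \<le> l"
      by (simp add: S_less_iff)
    moreover have "p \<noteq> 0" if "l = D"
      using inner assms that by (auto simp: n_asc_def)
    ultimately have "new (Suc l) = 0 \<or> p \<noteq> 0"
      using new_high[of "Suc l"] by (cases "l = D") auto
    then show ?thesis
      using inner new_le[of "Suc l"] by auto
  next
    case (last l)
    then show ?thesis
      using W_pred_le[of l] by (simp add: S_Suc)
  qed
qed

section \<open>The d-closed simples and the growth of the closure\<close>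

lemma d_closed_H:
  "d_closed d (kupisch F n) (Suc x) \<longleftrightarrow>
    (\<exists>b. 1 \<le> b \<and> b \<le> n \<and> x = F b) \<or>
    (\<exists>b. x < b \<and> b \<le> n \<and> F b \<le> x \<and> d \<le> pdim (kupisch F n) (Suc x) b)"
  by (auto simp: d_closed_def is_mod_kupisch_F is_proj_kupisch_F Suc_le_eq less_Suc_eq_le)

text \<open>For x = F n the simple is torsionless. Any other x in the range is the end of a branch,
  skipped by \<open>F\<close> between two levels; the full branch length h gives dimension
  2h.\<close>

lemma closed_between:
  assumes "0 < n" "F n \<le> x" "x < F (Suc n)"
  shows "d_closed (2 * h) (kupisch F n) (Suc x)"
proof (cases "x = F n")
  case True
  then show ?thesis
    using assms(1) by (auto simp: d_closed_H Suc_le_eq)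
next
  case False
  from assms(1) show ?thesis
  proof (cases rule: F_Suc_cases)
    case (inner l p)
    then show ?thesis
      using False assms by auto
  next
    case (last l)
    then have "W l (h - 1) < N l" "x = S l + N l"
      using False assms N_cases[of l] by (auto simp: S_Suc)
    then have "pdim (kupisch F n) (Suc x) n = 2 * (h - 1) + 2"
      using pdim_next_level[of "N (Suc l)" l "N l" n "h - 1"] last(1) h_pos by (simp add: N_Suc)
    moreover have "x < n" "F n \<le> x"
      using assms last by auto
    ultimately show ?thesis
      using h_pos by (auto simp: d_closed_H)
  qed
qed

lemma pdim_same_level_less:
  assumes "p < q" "q \<le> N l" "S l + q \<le> n"
  shows "pdim (kupisch F n) (Suc (S l + p)) (S l + q) < 2 * h"
proof -
  have "0 < q"
    using assms by simp
  then obtain k where "k < h" "W l k < q" "q \<le> W l (Suc k)"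
    using assms(2) W_jump by blast
  then show ?thesis
    using pdim_same_level[OF assms, of k] by simp
qed

text \<open>By \<open>F_strict\<close> the vertex F (n + 1) has no child yet. A top on its own level
  gives an odd dimension below 2h; a top on the next level would give 2h only at the end of a
  branch, which is never a parent.\<close>

lemma not_closed:
  assumes "n_asc \<le> n"
  shows "\<not> d_closed (2 * h) (kupisch F n) (Suc (F (Suc n)))"
proof -
  have F_lt: "F b < F (Suc n)" if "b \<le> n" for b
    using F_mono[OF that] F_strict[OF assms] by simp
  have "pdim (kupisch F n) (Suc (F (Suc n))) b < 2 * h" if b: "F (Suc n) < b" "b \<le> n" for b
  proof -
    obtain l' r where r: "b = S l' + r" "r \<le> N l'"
      by (rule position)
    have "0 < n"
      using assms by (simp add: n_asc_def)
    then show ?thesis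
    proof (cases rule: F_Suc_cases)
      case (inner l p)
      let ?q = "Suc p - new (Suc l)"
      have q: "0 < ?q" "?q \<le> W l (h - 1)"
        using inner F_strict[OF assms] N_Suc[of l] by auto
      have "S l < S (Suc l')" "S l' < S (Suc (Suc l))"
        using r b inner by (auto simp: S_Suc[of l'] S_Suc[of "Suc l"])
      then consider "l' = l" | "l' = Suc l"
        unfolding S_less_iff by linarith
      then show ?thesis
      proof cases
        case 1
        then show ?thesis
          using pdim_same_level_less[of ?q r l n] r b inner by simp
      next
        case 2
        obtain k where k: "k < h - 1" "W l k < ?q" "?q \<le> W l (Suc k)"
          using q W_jump by blast
        then have "2 * k + 2 < 2 * h"
          by linarith
        moreover have "r - new (Suc l) < ?q"
          using F_lt[of b] b inner r 2 by (simp add: F_position)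
        ultimately show ?thesis
          using pdim_next_level[of r l ?q n k] k r b inner 2 q W_pred_le[of l] by simp
      qed
    next
      case (last l)
      have "S (Suc l) < S (Suc l')" "S l' < S (Suc (Suc l))"
        using r b last by (auto simp: S_Suc[of l'] S_Suc[of "Suc l"])
      then have "l' = Suc l"
        unfolding S_less_iff by linarith
      then show ?thesis
        using pdim_same_level_less[of 0 r "Suc l" n] r b last by simp
    qed
  qed
  then have "\<not> 2 * h \<le> pdim (kupisch F n) (Suc (F (Suc n))) b" if "F (Suc n) < b" "b \<le> n" for b
    using that by (simp add: not_le)
  moreover have "F (Suc n) \<noteq> F b" if "b \<le> n" for b
    using F_lt[OF that] by simp
  ultimately show ?thesis
    unfolding d_closed_H by blast
qed

text \<open>The d-closed factors run from the socle of P(omega) up to index F (n + 1). So a nonzero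
  cliff module is (F (n + 1) + 1, n), and the extension adds vertex n + 1 of the tree.\<close>

lemma cliff_top_H:
  assumes "n_asc \<le> n"
  shows "cliff_top_of_U (2 * h) (kupisch F n) = F (Suc n)"
proof -
  have n: "0 < n" "1 \<le> n"
    using assms by (simp_all add: n_asc_def)
  then have low: "length (kupisch F n) + 1 - kc (kupisch F n) (length (kupisch F n)) = Suc (F n)"
    using F_less[of n] by (simp add: kc_kupisch)
  show ?thesis
    unfolding cliff_top_of_U_def low
  proof (rule Greatest_equality)
    have "d_closed (2 * h) (kupisch F n) j" if "Suc (F n) \<le> j" "j \<le> F (Suc n)" for j
      using closed_between[of n "j - 1"] that n by simp
    then show "F (Suc n) \<le> length (kupisch F n) \<and>
        (\<forall>j. Suc (F n) \<le> j \<and> j \<le> F (Suc n) \<longrightarrow> d_closed (2 * h) (kupisch F n) j)"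
      using F_less[of "Suc n"] by simp
  next
    fix k assume k: "k \<le> length (kupisch F n) \<and>
        (\<forall>j. Suc (F n) \<le> j \<and> j \<le> k \<longrightarrow> d_closed (2 * h) (kupisch F n) j)"
    show "k \<le> F (Suc n)"
    proof (rule ccontr)
      assume "\<not> k \<le> F (Suc n)"
      then have "d_closed (2 * h) (kupisch F n) (Suc (F (Suc n)))"
        using k F_strict[OF assms] by simp
      then show False
        using not_closed[OF assms] by simp
    qed
  qed
qed

text \<open>Every level from 1 to D + h meets a branch, so c_(i+1) >= 2, and the cliff module stays
  nonzero until \<open>n_closure\<close>.\<close>

lemma F_Suc_less:
  assumes "0 < i" "i < n_closure"
  shows "F (Suc i) < i"
  using assms(1)
proof (cases rule: F_Suc_cases)
  case (inner l p)
  have "S (Suc l) < S (Suc (D + h))"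
    using inner assms(2) by (simp add: n_closure_def)
  then have l: "l < D + h"
    by (simp add: S_less_iff)
  have "0 < N l \<or> new (Suc l) = 1"
  proof (cases l)
    case 0
    then show ?thesis
      using inner(2) N_Suc[of 0] new_le[of 1] by simp
  next
    case (Suc l')
    then show ?thesis
      using N_pos[of l] l by simp
  qed
  then show ?thesis
    using inner by (auto simp: S_Suc)
next
  case (last l)
  have "S (Suc l) < S (Suc (D + h))"
    using last assms(2) by (simp add: n_closure_def)
  then show ?thesis
    using N_pos[of "Suc l"] last by (simp add: S_less_iff)
qed

lemma F_Suc_n_closure: "F (Suc n_closure) = n_closure"
  using F_first[of "Suc (D + h)"] N_end by (simp add: n_closure_def S_Suc[of "Suc (D + h)"])

lemma cliff_len_H: "n_asc \<le> n \<Longrightarrow> cliff_len (2 * h) (kupisch F n) = n - F (Suc n)"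
  by (simp add: cliff_len_def cliff_top_H)

lemma E_ext_H:
  assumes "n_asc \<le> n" "n < n_closure"
  shows "E_ext (2 * h) (kupisch F n) = kupisch F (Suc n)"
proof -
  have "F (Suc n) < n"
    using assms by (intro F_Suc_less) (simp_all add: n_asc_def)
  then show ?thesis
    using cliff_len_H[OF assms(1)] by (simp add: E_ext_def kupisch_Suc)
qed

lemma C_closure_H: "C_closure (2 * h) (kupisch F n_asc) = kupisch F n_closure"
proof -
  have iter: "(E_ext (2 * h) ^^ t) (kupisch F n_asc) = kupisch F (n_asc + t)"
    if "t \<le> n_closure - n_asc" for t
    using that by (induction t) (simp_all add: E_ext_H)
  have "(LEAST t. cliff_len (2 * h) ((E_ext (2 * h) ^^ t) (kupisch F n_asc)) = 0)
      = n_closure - n_asc"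
  proof (rule Least_equality)
    show "cliff_len (2 * h) ((E_ext (2 * h) ^^ (n_closure - n_asc)) (kupisch F n_asc)) = 0"
      using iter[of "n_closure - n_asc"] n_asc_le cliff_len_H[of n_closure] F_Suc_n_closure by simp
  next
    fix t assume t: "cliff_len (2 * h) ((E_ext (2 * h) ^^ t) (kupisch F n_asc)) = 0"
    show "n_closure - n_asc \<le> t"
    proof (rule ccontr)
      assume "\<not> n_closure - n_asc \<le> t"
      then have "cliff_len (2 * h) (kupisch F (n_asc + t)) = 0" "n_asc + t < n_closure"
        using t iter[of t] by simp_all
      then show False
        using cliff_len_H[of "n_asc + t"] F_Suc_less[of "n_asc + t"] by (simp add: n_asc_def)
    qed
  qed
  then show ?thesis
    using iter[of "n_closure - n_asc"] n_asc_le by (simp add: C_closure_def)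
qed

section \<open>The ascent algebra\<close>

lemma is_LNakayama_H:
  assumes "0 < n" "n \<le> n_closure"
  shows "is_LNakayama (kupisch F n)"
proof -
  have gap: "2 \<le> Suc i - F (Suc i) \<and> Suc i - F (Suc i) \<le> (i - F i) + 1" if "0 < i" "i < n" for i
  proof -
    have "F (Suc i) < i" "F i \<le> F (Suc i)"
      using that assms(2) F_Suc_less[of i] F_le_Suc[of i] by simp_all
    then show ?thesis
      by (intro conjI) linarith+
  qed
  have "2 \<le> kupisch F n ! i \<and> kupisch F n ! i \<le> kupisch F n ! (i - 1) + 1"
    if "0 < i" "i < n" for i
    using gap[OF that] that nth_kupisch[of i n F] nth_kupisch[of "i - 1" n F] by simp
  moreover have "kupisch F n \<noteq> []"
    using assms(1) length_kupisch[of F n] by force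
  moreover have "kupisch F n ! 0 = 1"
    using assms(1) by (simp add: nth_kupisch F_1)
  ultimately show ?thesis
    unfolding is_LNakayama_def length_kupisch by blast
qed

text \<open>No branch ends before level D, so \<open>F\<close> skips no vertex in this
  range.\<close>

lemma F_Suc_le_asc:
  assumes "i < n_asc"
  shows "F (Suc i) \<le> Suc (F i)"
proof (cases "i = 0")
  case False
  then have "0 < i"
    by simp
  then show ?thesis
  proof (cases rule: F_Suc_cases)
    case (last l)
    have "S (Suc l) \<le> S (Suc D)"
      using last assms by (simp add: n_asc_def)
    moreover have "l \<noteq> D"
      using last assms N_Suc_D_pos by (auto simp: n_asc_def)
    ultimately have "l < D"
      by (simp add: S_le_iff)
    then have "\<not> (\<exists>m\<in>set ms. l + m = Suc (D + (h - 1)))"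
      using le_D D_le_h by fastforce
    then have "N l = W l (h - 1)"
      using W_Suc_right[of l "h - 1"] h_pos by simp
    then show ?thesis
      using last by (simp add: S_Suc)
  qed auto
qed (simp add: F_1)

lemma sorted_asc: "sorted (kupisch F n_asc)"
proof -
  have "i - F i \<le> Suc i - F (Suc i)" if "i < n_asc" for i
    using F_Suc_le_asc[OF that] by simp
  then show ?thesis
    by (simp add: sorted_iff_nth_Suc nth_kupisch)
qed

lemma ascent_unique:
  assumes xs: "is_LNakayama xs" "sorted xs"
    and char: "char_proj_omega xs = map (\<lambda>m. 2 * m - 1) (tl ms) @ [0, 1]"
  shows "xs = kupisch F n_asc"
proof -
  define G where "G = (\<lambda>i. i - kc xs i)"
  define n where "n = length xs"
  define a where "a = G n"
  have xs_eq: "xs = kupisch G n"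
    using kupisch_of_parent[OF xs(1)] by (simp add: G_def n_def)
  interpret mono_parent_map G n
    using mono_parent_map_LNakayama[OF xs(1)] by (simp add: G_def n_def)
  have n_pos: "0 < n"
    using xs(1) by (simp add: is_LNakayama_def n_def)
  have kc_n: "kc xs n \<le> n"
    using kc_le_index[OF xs(1), of n] n_pos by (simp add: n_def Suc_le_eq)
  let ?p = "pdim (kupisch G n)"
  let ?z = "\<lambda>i. if odd (?p i i) then ?p i i else ?p (Suc a) n"
  have "length xs + 1 - kc xs (length xs) = Suc a"
    using kc_n by (simp add: a_def G_def n_def)
  then have "char_proj_omega xs = map ?z [Suc a..<n + 1]"
    unfolding char_proj_omega_def charseq_def xs_eq[symmetric] n_def[symmetric] by simp
  then have z: "map ?z [Suc a..<n + 1] = map (\<lambda>m. 2 * m - 1) (tl ms) @ [0, 1]"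
    using char by simp
  have "n - a = u + 2"
    using arg_cong[OF z, of length] length_ms by (simp del: upt_Suc)
  then have n_eq: "n = Suc (Suc (a + u))"
    by simp
  have G_n: "G n = a"
    by (simp add: a_def)
  have proj: "?p (Suc a) n = 0"
    using pdim_step[of n a] n_eq G_n by simp
  have z_nth: "?z (Suc (a + i)) = (map (\<lambda>m. 2 * m - 1) (tl ms) @ [0, 1]) ! i" if "i < u + 2" for i
  proof -
    have "?z (Suc a + i) = map ?z [Suc a..<n + 1] ! i"
      by (rule nth_map_upt[symmetric]) (use that n_eq in simp)
    then show ?thesis
      unfolding z add_Suc .
  qed
  have ms_pos: "0 < ms ! Suc i" if "i < u" for i
    using sorted_wrt_nth_less[OF sorted_ms, of 0 "Suc i"] that length_ms by simp
  \<comment> \<open>Positive entries cannot be the default value, which is 0 for a projective, so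
    they are dimensions of simples. The entry 0 only reveals that its simple is even.\<close>
  have p_gap: "?p (Suc (a + i)) (Suc (a + i)) = 2 * (ms ! Suc i - 1) + 1" if "i < u" for i
    using z_nth[of i] that ms_pos[OF that] length_ms proj
    by (auto simp: nth_append nth_tl split: if_splits)
  have p_mid: "even (?p (Suc (a + u)) (Suc (a + u)))"
    using z_nth[of u] length_ms proj by (auto simp: nth_append split: if_splits)
  have p_last: "?p n n = 2 * 0 + 1"
    using z_nth[of "Suc u"] length_ms proj n_eq by (auto simp: nth_append split: if_splits)
  have G_a: "G (Suc (a + u)) = a"
    using odd_pdim_funpow[of n "Suc (a + u)" 0] p_last parent_less[of n] n_eq G_n by simp
  have G_le: "G i \<le> i" for i
    by (simp add: G_def)
  have step: "G i \<le> G (Suc i) \<and> G (Suc i) \<le> Suc (G i)" if "i < n" for i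
  proof -
    have "kc xs i \<le> kc xs (Suc i)" if "0 < i"
      using xs(2) \<open>i < n\<close> that by (simp add: kc_def n_def sorted_iff_nth_mono)
    moreover have "G (Suc 0) = 0"
      using xs(1) by (simp add: G_def kc_def is_LNakayama_def)
    ultimately have "G (Suc i) \<le> Suc (G i)"
      by (cases "i = 0") (auto simp: G_def)
    then show ?thesis
      using parent_mono[of i "Suc i"] that by simp
  qed
  have pow_step: "(G ^^ k) v \<le> (G ^^ k) (Suc v) \<and> (G ^^ k) (Suc v) \<le> Suc ((G ^^ k) v)"
    if "v < n" for k v
    using funpow_Suc_le[of n G v k] step G_le that by blast
  have pow_le: "(G ^^ k) v \<le> v" for k v
    by (induction k) (auto intro: G_le order_trans)
  \<comment> \<open>The neighbours a + j and a + j + 1 merge after exactly m_(j+1) iterations and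
    stay adjacent before. So k iterations close the leftmost \<open>W D k\<close> gaps.\<close>
  have window: "(G ^^ k) (a + j) = (G ^^ k) a + (j - W D k)" if "j \<le> u" for j k
    using that
  proof (induction j)
    case (Suc j)
    let ?m = "ms ! Suc j"
    have gap: "\<forall>i\<le>?m - 1. (G ^^ i) (a + j) < (G ^^ i) (Suc (a + j))"
      "(G ^^ ?m) (a + j) = (G ^^ ?m) (Suc (a + j))"
      using odd_pdim_funpow[of "Suc (a + j)" "a + j" "?m - 1"] p_gap[of j] Suc.prems
        parent_less[of "Suc (a + j)"] n_eq ms_pos[of j] by auto
    show ?case
    proof (cases "?m \<le> k")
      case True
      then have "(G ^^ k) v = (G ^^ (k - ?m)) ((G ^^ ?m) v)" for v
        using funpow_add[of "k - ?m" ?m G] by simp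
      then have "(G ^^ k) (a + j) = (G ^^ k) (Suc (a + j))"
        using gap(2) by simp
      moreover have "Suc j \<le> W D k"
        using True le_W_D_iff[of "Suc j" k] Suc.prems by simp
      ultimately show ?thesis
        using Suc by simp
    next
      case False
      then have "(G ^^ k) (a + j) < (G ^^ k) (Suc (a + j))"
        using gap(1) by simp
      then have "(G ^^ k) (Suc (a + j)) = Suc ((G ^^ k) (a + j))"
        using pow_step[of "a + j" k] n_eq Suc.prems by simp
      moreover have "W D k \<le> j"
        using False le_W_D_iff[of "Suc j" k] Suc.prems by simp
      ultimately show ?thesis
        using Suc by simp
    qed
  qed simp
  have swap: "(G ^^ Suc k) (Suc (a + u)) = (G ^^ k) a" for k
    using G_a by (simp add: funpow_swap1)
  \<comment> \<open>Only the parity of this dimension is known. The window shows that K is the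
    number of iterations after which a, ..., a + u coincide, namely D.\<close>
  obtain K where K: "?p (Suc (a + u)) (Suc (a + u)) = 2 * K"
    using p_mid by blast
  have mid: "\<forall>i\<le>K. (G ^^ i) (a + u) < (G ^^ i) (Suc (a + u))"
    "\<forall>i<K. (G ^^ i) a < (G ^^ i) (a + u)" "(G ^^ K) a = (G ^^ K) (a + u)"
    using even_pdim_funpow[of "Suc (a + u)" "a + u" K] K parent_less[of "Suc (a + u)"] n_eq
    unfolding swap by auto
  have W_D_D: "W D D = u"
    using N_low[of 0] by simp
  have "W D K = u"
    using mid(3) window[of u K] W_D_le[of K] by simp
  then have "D \<le> K"
    using le_W_D_iff[of u K] nth_u hd_ms by (cases "u = 0") auto
  moreover have "\<not> D < K"
    using mid(2) window[of u D] W_D_D by auto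
  ultimately have "K = D"
    by simp
  have adj: "(G ^^ i) (Suc (a + u)) = Suc ((G ^^ i) (a + u))" if "i \<le> D" for i
    using mid(1) that \<open>K = D\<close> pow_step[of "a + u" i] n_eq by (simp add: le_antisym Suc_le_eq)
  \<comment> \<open>The window has collapsed to v, and v + 1 has parent v. So c_(v+1) = 1, which
    only the simple projective S_1 allows.\<close>
  define v where "v = (G ^^ D) a"
  have Suc_v: "(G ^^ D) (Suc (a + u)) = Suc v"
    using adj[of D] window[of u D] W_D_D v_def by simp
  then have "G (Suc v) = v"
    using swap[of D] v_def by simp
  moreover have "Suc v \<le> n"
    using Suc_v pow_le[of D "Suc (a + u)"] n_eq by simp
  ultimately have "v = 0"
    using kc_ge_2[OF xs(1), of "Suc v"] unfolding G_def n_def by (cases "v = 0") auto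
  \<comment> \<open>The (D - l)-th iterate maps the window onto level l; by \<open>adj\<close> and
    \<open>swap\<close> the vertex after its image is the spine vertex of level l + 1.\<close>
  have start: "(G ^^ (D - l)) a = S l" if "l \<le> D" for l
    using that
  proof (induction l)
    case 0
    then show ?case
      using \<open>v = 0\<close> v_def by simp
  next
    case (Suc l)
    then have D_l: "D - l = Suc (D - Suc l)"
      by simp
    have "(G ^^ (D - Suc l)) a = Suc ((G ^^ (D - l)) (a + u))"
      using adj[of "D - l"] swap[of "D - Suc l"] D_l by simp
    moreover have "u - W D (D - l) = N l"
      using N_low[of l] Suc.prems by simp
    ultimately show ?case
      using Suc window[of u "D - l"] by (simp add: S_Suc)
  qed
  have a: "a = S D"
    using start[of D] by simp
  then have n: "n = n_asc"
    using n_eq n_asc_eq by simp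
  have "G i = F i" if i: "1 \<le> i" "i \<le> n" for i
  proof -
    have "0 < i"
      using i by simp
    then obtain l p where lp: "i = S (Suc l) + p" "p \<le> N (Suc l)"
      by (rule position_Suc)
    show ?thesis
    proof (cases "l < D")
      case True
      let ?k = "D - Suc l"
      have k: "D - l = Suc ?k"
        using True by simp
      have j: "p + W D ?k \<le> u"
        using lp(2) N_low[of "Suc l"] True by simp
      \<comment> \<open>Vertex i is an iterated parent of a window vertex; the offset
        \<open>W D ?k\<close> skips the closed gaps, and one more iteration gives
        \<open>G i\<close>.\<close>
      have "i = (G ^^ ?k) (a + (p + W D ?k))"
        using window[OF j, of ?k] start[of "Suc l"] True lp(1) by simp
      then have "G i = (G ^^ (D - l)) (a + (p + W D ?k))"
        by (simp add: k)
      also have "\<dots> = S l + (p + W D ?k - W D (D - l))"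
        using window[OF j, of "D - l"] start[of l] True by simp
      also have "\<dots> = F i"
        using new_low[OF True] lp by (simp add: F_position)
      finally show ?thesis .
    next
      case False
      have "S (Suc l) < S (Suc (Suc D))"
        using lp i n N_Suc_D_pos by (simp add: n_asc_def S_Suc[of "Suc D"])
      then have "l = D"
        using False by (simp add: S_less_iff)
      then have "i = S (Suc D) \<or> i = n_asc"
        using lp i n by (auto simp: n_asc_def)
      then show ?thesis
        using G_a F_n_asc a n G_n by (auto simp: S_Suc N_D)
    qed
  qed
  then show ?thesis
    using xs_eq n kupisch_cong[of n G F] by simp
qed

lemma ascent_H: "ascent (map (\<lambda>m. 2 * m - 1) (tl ms) @ [0, 1]) = kupisch F n_asc"
  unfolding ascent_def
proof (rule the_equality)
  have "0 < n_asc"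
    by (simp add: n_asc_def)
  moreover have "char_proj_omega (kupisch F n_asc) = map (\<lambda>m. 2 * m - 1) (tl ms) @ [0, 1]"
    using charseq_first[of n_asc] F_less[of n_asc] F_n_asc
    by (simp add: char_proj_omega_def kc_kupisch n_asc_eq Suc_diff_le)
  ultimately show "is_LNakayama (kupisch F n_asc) \<and> sorted (kupisch F n_asc) \<and>
      char_proj_omega (kupisch F n_asc) = map (\<lambda>m. 2 * m - 1) (tl ms) @ [0, 1]"
    using is_LNakayama_H n_asc_le sorted_asc by simp
qed (use ascent_unique in blast)

section \<open>Summits\<close>

text \<open>On level l + 1 the length is \<open>N l\<close> + 1, plus \<open>new (Suc l)\<close> off
  the spine. The value u + 2 comes from all u + 1 branches when D < l <= h, and from u branches and
  the start of branch 0 when l = D.\<close>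

lemma length_proj_le:
  assumes "0 < b"
  shows "b - F b \<le> u + 2" "b - F b = u + 2 \<longleftrightarrow> n_asc \<le> b \<and> b < S (h + 2)"
proof -
  obtain l p where lp: "b = S (Suc l) + p" "p \<le> N (Suc l)"
    using assms by (rule position_Suc)
  have "F b = S l + (p - new (Suc l))" "b = Suc (S l + N l + p)"
    using lp by (simp_all add: F_position) (simp add: S_Suc)
  then have len: "b - F b = Suc (N l) + (p - (p - new (Suc l)))"
    by simp
  have le: "N l \<le> Suc u"
    by (rule W_le)
  have lower: "n_asc \<le> b \<longleftrightarrow> D < l \<or> (l = D \<and> 0 < p)"
  proof (cases "l < D")
    case True
    then have "S (Suc (Suc l)) \<le> S (Suc D)"
      by (simp add: S_le_iff)
    then show ?thesis
      using lp True by (simp add: n_asc_def S_Suc[of "Suc l"])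
  next
    case False
    show ?thesis
    proof (cases "l = D")
      case False
      then have "S (Suc D) < S (Suc l)"
        using \<open>\<not> l < D\<close> by (simp add: S_less_iff)
      then show ?thesis
        using False \<open>\<not> l < D\<close> lp by (simp add: n_asc_def)
    qed (use lp in \<open>auto simp: n_asc_def\<close>)
  qed
  have upper: "b < S (h + 2) \<longleftrightarrow> l \<le> h"
  proof
    assume "b < S (h + 2)"
    then have "S (Suc l) < S (h + 2)"
      using lp by simp
    then show "l \<le> h"
      by (simp add: S_less_iff)
  next
    assume "l \<le> h"
    then have "S (Suc (Suc l)) \<le> S (h + 2)"
      by (simp add: S_le_iff)
    then show "b < S (h + 2)"
      using lp by (simp add: S_Suc[of "Suc l"])
  qed
  have "b - F b \<le> u + 2 \<and> (b - F b = u + 2 \<longleftrightarrow> (D < l \<or> (l = D \<and> 0 < p)) \<and> l \<le> h)"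
  proof (cases "D < l")
    case True
    then show ?thesis
      using len le new_high[of "Suc l"] N_full_iff[of l] by auto
  next
    case False
    show ?thesis
    proof (cases "l = D")
      case True
      then show ?thesis
        using len D_le_h by (cases p) (simp_all add: N_D)
    next
      case False
      then have "l < D"
        using \<open>\<not> D < l\<close> by simp
      then have "N l + new (Suc l) \<le> u"
        using new_low[of l] N_low[of l] by simp
      then have "b - F b < u + 2"
        using len by linarith
      then show ?thesis
        using \<open>l < D\<close> by simp
    qed
  qed
  then show "b - F b \<le> u + 2" "b - F b = u + 2 \<longleftrightarrow> n_asc \<le> b \<and> b < S (h + 2)"
    using lower upper by auto
qed

lemma S_h2_le: "S (h + 2) \<le> Suc n_closure"
proof (cases "D = 0")
  case True
  then show ?thesis
    using N_end by (simp add: n_closure_def S_Suc[of "Suc h"])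
next
  case False
  then have "S (h + 2) \<le> S (Suc (D + h))"
    by (simp add: S_le_iff)
  then show ?thesis
    by (simp add: n_closure_def)
qed

lemma n_asc_less: "n_asc < S (h + 2)"
  using length_proj_le(2)[of n_asc] F_n_asc n_asc_eq by simp

lemma height_H: "height (kupisch F n_closure) = u + 2"
  unfolding height_def
proof (rule Max_eqI)
  have "{b + 1 - a | a b. is_mod (kupisch F n_closure) a b} \<subseteq> {..Suc n_closure}"
    by (auto simp: is_mod_kupisch_F)
  then show "finite {b + 1 - a | a b. is_mod (kupisch F n_closure) a b}"
    by (rule finite_subset) simp
next
  fix y assume "y \<in> {b + 1 - a | a b. is_mod (kupisch F n_closure) a b}"
  then obtain a b where "y = b + 1 - a" "1 \<le> a" "a \<le> b" "F b < a"
    by (auto simp: is_mod_kupisch_F)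
  then show "y \<le> u + 2"
    using length_proj_le(1)[of b] by simp
next
  have "is_mod (kupisch F n_closure) (Suc (S D)) n_asc"
    using n_asc_le F_n_asc n_asc_eq by (simp add: is_mod_kupisch_F)
  then show "u + 2 \<in> {b + 1 - a | a b. is_mod (kupisch F n_closure) a b}"
    using n_asc_eq by (intro CollectI exI[of _ "Suc (S D)"] exI[of _ n_asc]) simp
qed

lemma summits_H: "summits (kupisch F n_closure) = (\<lambda>b. (Suc (F b), b)) ` {n_asc..<S (h + 2)}"
proof -
  have "(a, b) \<in> summits (kupisch F n_closure) \<longleftrightarrow> a = Suc (F b) \<and> n_asc \<le> b \<and> b < S (h + 2)"
    for a b
  proof
    assume "(a, b) \<in> summits (kupisch F n_closure)"
    then have ab: "1 \<le> a" "a \<le> b" "F b < a" "b + 1 - a = u + 2"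
      by (auto simp: summits_def is_mod_kupisch_F height_H)
    then have "b - F b = u + 2"
      using length_proj_le(1)[of b] by simp
    then show "a = Suc (F b) \<and> n_asc \<le> b \<and> b < S (h + 2)"
      using ab length_proj_le(2)[of b] by simp
  next
    assume ab: "a = Suc (F b) \<and> n_asc \<le> b \<and> b < S (h + 2)"
    then have "0 < b"
      by (simp add: n_asc_def)
    then show "(a, b) \<in> summits (kupisch F n_closure)"
      using ab length_proj_le(2)[of b] S_h2_le by (simp add: summits_def is_mod_kupisch_F height_H)
  qed
  then show ?thesis
    by (auto simp: image_iff)
qed

lemma S_diff: "k \<le> h - D \<Longrightarrow> S (Suc D + k) = S (Suc D) + k * (u + 2)"
proof (induction k)
  case (Suc k)
  then have "N (Suc D + k) = Suc u"
    by (simp add: N_full_iff)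
  then show ?case
    using Suc by (simp add: S_Suc[of "Suc D + k", simplified])
qed simp

text \<open>Levels D + 1, ..., h have u + 2 vertices each and level h + 1 has u + 1; the spine
  vertex of level D + 1 is left out.\<close>

lemma card_summits_H: "card (summits (kupisch F n_closure)) = (u + 2) * (h - D) + u"
proof -
  have "card (summits (kupisch F n_closure)) = S (h + 2) - n_asc"
    unfolding summits_H by (subst card_image) (auto intro: inj_onI)
  moreover have "S (h + 2) = S (Suc h) + Suc u"
    by (simp add: S_Suc[of "Suc h"] N_Suc_h)
  moreover have "S (Suc h) = S (Suc D) + (h - D) * (u + 2)"
    using S_diff[of "h - D"] D_le_h by simp
  ultimately show ?thesis
    by (simp add: n_asc_def)
qed

lemma first_summit_H:
  "first_summit (kupisch F n_closure) a b \<longleftrightarrow> a = Suc (S D) \<and> b = n_asc"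
proof
  assume "first_summit (kupisch F n_closure) a b"
  then have ab: "a = Suc (F b)" "n_asc \<le> b" "b < S (h + 2)"
      and "a = b \<or> is_proj (kupisch F n_closure) a (b - 1)"
    unfolding first_summit_def summits_H by auto
  have len: "b - F b = u + 2"
    using length_proj_le(2)[of b] ab by (simp add: n_asc_def)
  then have "is_proj (kupisch F n_closure) a (b - 1)"
    using ab \<open>a = b \<or> _\<close> by auto
  then have b: "1 \<le> b - 1" "F b = F (b - 1)"
    using ab by (simp_all add: is_proj_kupisch_F)
  \<comment> \<open>P_b and its projective radical differ in length by one, so b - 1 is not the top
    of a summit.\<close>
  then have "b - 1 - F (b - 1) \<noteq> u + 2"
    using len by simp
  moreover have "0 < b - 1" "b - 1 < S (h + 2)"
    using ab(3) b(1) by simp_all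
  ultimately have "\<not> n_asc \<le> b - 1"
    using length_proj_le(2) by blast
  then have "b = n_asc"
    using ab(2) by linarith
  then show "a = Suc (S D) \<and> b = n_asc"
    using ab(1) F_n_asc(1) by simp
next
  assume ab: "a = Suc (S D) \<and> b = n_asc"
  have "is_proj (kupisch F n_closure) (Suc (S D)) (n_asc - 1)"
    using F_n_asc n_asc_le by (simp add: is_proj_kupisch_F) (simp add: n_asc_def S_Suc)
  then show "first_summit (kupisch F n_closure) a b"
    using ab F_n_asc n_asc_less unfolding first_summit_def summits_H
    by (auto intro!: image_eqI[of _ _ n_asc])
qed

lemma F_last_summit: "F (S (h + 2) - 1) = S h + W h (h - 1)" "S (h + 2) - 1 = S (Suc h) + u"
  using F_last[of h] by (simp_all add: S_Suc[of "Suc h"] N_Suc_h)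

lemma last_summit_H:
  "last_summit (kupisch F n_closure) a b \<longleftrightarrow> a = Suc (S h + W h (h - 1)) \<and> b = S (h + 2) - 1"
proof
  assume "last_summit (kupisch F n_closure) a b"
  then have ab: "a = Suc (F b)" "n_asc \<le> b" "b < S (h + 2)"
      and "a = b \<or> is_inj (kupisch F n_closure) (a + 1) b"
    unfolding last_summit_def summits_H by auto
  have len: "b - F b = u + 2"
    using length_proj_le(2)[of b] ab by (simp add: n_asc_def)
  then have inj: "is_inj (kupisch F n_closure) (a + 1) b"
    using ab \<open>a = b \<or> _\<close> by auto
  \<comment> \<open>If b + 1 were the top of a summit, Q/soc Q would be the radical of P_(b+1),
    hence not injective.\<close>
  have "\<not> Suc b < S (h + 2)"
  proof
    assume lt: "Suc b < S (h + 2)"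
    then have "Suc b - F (Suc b) = u + 2"
      using length_proj_le(2)[of "Suc b"] ab by simp
    then have "F (Suc b) = Suc (F b)"
      using len by linarith
    then show False
      using inj len lt ab S_h2_le by (simp add: is_inj_def is_mod_kupisch_F)
  qed
  then have "b = S (h + 2) - 1"
    using ab(3) by linarith
  then show "a = Suc (S h + W h (h - 1)) \<and> b = S (h + 2) - 1"
    using ab(1) F_last_summit(1) by simp
next
  assume ab: "a = Suc (S h + W h (h - 1)) \<and> b = S (h + 2) - 1"
  then have F: "a = Suc (F b)" "Suc b = S (h + 2)"
    using F_last_summit n_asc_less by simp_all
  have len: "b - F b = u + 2"
    using length_proj_le(2)[of b] ab n_asc_less by (simp add: n_asc_def)
  have "Suc b - F (Suc b) < u + 2"
    using length_proj_le[of "Suc b"] F(2) by (simp add: le_less)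
  then have "\<not> is_mod (kupisch F n_closure) (a + 1) (b + 1)"
    using len F by (auto simp: is_mod_kupisch_F)
  moreover have "is_mod (kupisch F n_closure) (a + 1) b"
    using len F S_h2_le by (simp add: is_mod_kupisch_F)
  ultimately have "is_inj (kupisch F n_closure) (a + 1) b"
    by (simp add: is_inj_def)
  moreover have "n_asc \<le> b"
    using n_asc_less ab by simp
  ultimately show "last_summit (kupisch F n_closure) a b"
    using F unfolding last_summit_def summits_H by auto
qed

text \<open>The factors are the end of the oldest branch on level h, whose age h gives 2h - 1, then
  the spine vertex of level h + 1 and the u branches left there, from young to old.\<close>

lemma charseq_last:
  "charseq (kupisch F n_closure) (Suc (S h + W h (h - 1))) (S (h + 2) - 1)
    = [2 * h - 1, 0] @ map (\<lambda>m. 2 * (h - D + m) + 1) (butlast ms)"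
proof -
  let ?n = n_closure
  let ?b = "S (h + 2) - 1"
  let ?a = "Suc (S h + W h (h - 1))"
  let ?p = "pdim (kupisch F ?n)"
  let ?z = "\<lambda>i. if odd (?p i i) then ?p i i else ?p ?a ?b"
  have b_le: "S (Suc h) + u \<le> ?n"
    using S_h2_le F_last_summit(2) by simp
  have "\<exists>m\<in>set ms. h + m = Suc (D + (h - 1))"
    using D_in h_pos by (intro bexI[of _ D]) auto
  then have N_h: "N h = Suc (W h (h - 1))"
    using W_Suc_right[of h "h - 1"] h_pos by simp
  then have S_h: "S (Suc h) = Suc ?a"
    by (simp add: S_Suc)
  have proj: "?p ?a ?b = 0"
    using pdim_step_F[of ?b "S h + W h (h - 1)" ?n] F_last_summit b_le S_h by simp
  have "?p (Suc (S h + W h (h - 1))) (S h + N h) = 2 * (h - 1) + 1"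
    using N_h b_le S_h h_pos by (intro pdim_same_level) simp_all
  then have z1: "?z ?a = 2 * h - 1"
    using N_h h_pos by simp
  have z2: "?z (S (Suc h)) = 0"
    using even_pdim_first[of h ?n] b_le proj by simp
  have rest: "map ?z [Suc (S (Suc h))..<Suc (S (Suc h)) + u]
      = map (\<lambda>m. 2 * (h - D + m) + 1) (butlast ms)"
  proof (rule nth_equalityI)
    fix i assume "i < length (map ?z [Suc (S (Suc h))..<Suc (S (Suc h)) + u])"
    then have i: "i < u"
      by (simp only: length_map length_upt)
    then have "?p (S (Suc h) + Suc i) (S (Suc h) + Suc i) = 2 * (h - D + ms ! i) + 1"
      using b_le by (intro pdim_simple_Suc_h) auto
    then show "map ?z [Suc (S (Suc h))..<Suc (S (Suc h)) + u] ! i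
        = map (\<lambda>m. 2 * (h - D + m) + 1) (butlast ms) ! i"
      using i length_ms by (simp add: nth_butlast del: upt_Suc)
  qed (simp add: length_ms)
  have "[?a..<?b + 1] = [?a, S (Suc h)] @ [Suc (S (Suc h))..<Suc (S (Suc h)) + u]"
    using F_last_summit(2) S_h by (simp add: upt_conv_Cons del: upt_Suc)
  then have "charseq (kupisch F ?n) ?a ?b = [?z ?a, ?z (S (Suc h))] @
      map ?z [Suc (S (Suc h))..<Suc (S (Suc h)) + u]"
    unfolding charseq_def by (simp only: map_append list.map)
  then show ?thesis
    using z1 z2 rest by simp
qed

end

section \<open>The summits of H in terms of c_1, ..., c_u\<close>

theorem theorem3:
  fixes d :: nat and cs :: "nat list"
  assumes "even d" and "2 \<le> d"
    and "sorted_wrt (<) cs"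
    and "\<forall>c\<in>set cs. odd c \<and> 0 < c \<and> c \<le> d"
  defines "H \<equiv> C_closure d (ascent (cs @ [0, 1]))"
  shows "(cs = [] \<longrightarrow>
            card (summits H) = d
          \<and> (\<exists>a b. first_summit H a b) \<and> (\<forall>a b. first_summit H a b \<longrightarrow> charseq H a b = [0, 1])
          \<and> (\<exists>a b. last_summit H a b) \<and> (\<forall>a b. last_summit H a b \<longrightarrow> charseq H a b = [d - 1, 0]))
       \<and> (cs \<noteq> [] \<longrightarrow>
          (let u = length cs; t = (d - last cs - 1) div 2 in
            last cs + 1 \<le> d
          \<and> card (summits H) = (u + 2) * t + u
          \<and> (\<exists>a b. first_summit H a b)
          \<and> (\<forall>a b. first_summit H a b \<longrightarrow> charseq H a b = cs @ [0, 1])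
          \<and> (\<exists>a b. last_summit H a b)
          \<and> (\<forall>a b. last_summit H a b \<longrightarrow>
                charseq H a b = [d - 1, 0, 1 + 2 * t] @ map (\<lambda>c. c + 2 * t + 2) (butlast cs))))"
proof -
  define half where "half = (\<lambda>c::nat. (c + 1) div 2)"
  \<comment> \<open>The prepended 0 is m_0; it yields the entry 1 + 2t of char Q.\<close>
  define ms where "ms = 0 # map half cs"
  define h where "h = d div 2"
  have d: "d = 2 * h"
    using assms(1) by (simp add: h_def)
  have half: "2 * half c = Suc c" if "c \<in> set cs" for c
    using assms(4) that by (auto simp: half_def elim!: oddE)
  \<comment> \<open>An odd c cannot equal the even d; this gives t >= 0.\<close>
  have lt_d: "c < d" if "c \<in> set cs" for c
    using assms(1,4) that by (metis le_neq_implies_less)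
  have half_mono: "half c < half c'" if "c \<in> set cs" "c' \<in> set cs" "c < c'" for c c'
    using half[OF that(1)] half[OF that(2)] that(3) by simp
  have half_le: "half c \<le> h" if "c \<in> set cs" for c
    using half[OF that] lt_d[OF that] d by simp
  interpret branched_spine ms h
  proof
    have "sorted_wrt (\<lambda>c c'. half c < half c') cs"
      by (rule sorted_wrt_mono_rel[OF _ assms(3)]) (use half_mono in blast)
    then show "sorted_wrt (<) ms"
      using half by (force simp: ms_def sorted_wrt_map)
    show "last ms \<le> h"
      using half_le by (auto simp: ms_def last_map)
    show "0 < h"
      using assms(2) d by simp
  qed (simp_all add: ms_def)
  have "map (\<lambda>m. 2 * m - 1) (tl ms) = cs"
    using half by (auto simp: ms_def intro!: map_idI)
  then have H: "H = kupisch F n_closure"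
    and first: "charseq (kupisch F n_closure) (Suc (S D)) n_asc = cs @ [0, 1]"
    using ascent_H C_closure_H charseq_first[OF n_asc_le] by (simp_all add: H_def d)
  have ex: "\<exists>a b. first_summit H a b" "\<exists>a b. last_summit H a b"
    by (simp_all only: H first_summit_H last_summit_H) blast+
  show ?thesis
  proof (cases "cs = []")
    case True
    then have "u = 0" "D = 0" "butlast ms = []"
      unfolding u_def D_def by (simp_all add: ms_def)
    then show ?thesis
      using True first charseq_last card_summits_H
      by (simp add: H first_summit_H last_summit_H d)
  next
    case False
    define t where "t = (d - last cs - 1) div 2"
    have last: "2 * half (last cs) = Suc (last cs)" "last cs < d"
      using half lt_d False by simp_all
    \<comment> \<open>Here c_u = 2D - 1 and d = 2h.\<close>
    then have t: "h - D = t"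
      unfolding D_def using False d by (simp add: t_def ms_def last_map)
    have u: "u = length cs"
      unfolding u_def by (simp add: ms_def)
    have "map (\<lambda>m. 2 * (h - D + m) + 1) (butlast ms)
        = (1 + 2 * t) # map (\<lambda>c. c + 2 * t + 2) (butlast cs)"
      unfolding t using False half in_set_butlastD[of _ cs]
      by (simp add: ms_def map_butlast[symmetric])
    then have "charseq H a b = [d - 1, 0, 1 + 2 * t] @ map (\<lambda>c. c + 2 * t + 2) (butlast cs)"
      if "last_summit H a b" for a b
      using that charseq_last by (simp add: H last_summit_H d)
    moreover have "charseq H a b = cs @ [0, 1]" if "first_summit H a b" for a b
      using that first by (simp add: H first_summit_H)
    moreover have "card (summits H) = (length cs + 2) * t + length cs"
      using card_summits_H by (simp only: H u t)
    moreover have "last cs + 1 \<le> d"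
      using last(2) by simp
    ultimately show ?thesis
      unfolding Let_def t_def[symmetric] using False ex by blast
  qed
qed

end
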